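(* Let $d\ge1$ and let $\{\mathbf{Y}_n\}_{n\ge 0}$ be an $\mathcal{S}_d^{+}$-valued backward submartingale adapted to a backward filtration $\{\mathcal{G}_n\}_{n\ge 0}$. Then for any deterministic $\mathbf{A}\in\mathcal{S}_d^{++}$, $$\mathbb{P}(\exists n\ge 0,\ \mathbf{Y}_n\not\preceq\mathbf{A})\le\mathrm{tr}\big((\mathbb{E}\,\mathbf{Y}_0)\mathbf{A}^{-1}\big).$$
   Context: $\mathcal{S}_d$ is the set of real symmetric $d\times d$ matrices, $\mathcal{S}_d^{+}$ the subset of positive semidefinite ones, $\mathcal{S}_d^{++}$ the subset of positive definite ones. $\preceq$ is the Loewner order: $\mathbf{A}\preceq\mathbf{B}$ iff $\mathbf{B}-\mathbf{A}$ is positive semidefinite; $\mathbf{A}\not\preceq\mathbf{B}$ is its negation. Expectations and conditional expectations of random matrices are entrywise. A backward filtration is a sequence of $\sigma$-algebras $\mathcal{G}_0\supseteq\mathcal{G}_1\supseteq\cdots$. An (integrable) $\mathcal{S}_d$-valued process $\{\mathbf{Y}_n\}_{n\ge0}$ with each $\mathbf{Y}_n$ being $\mathcal{G}_n$-measurable is a backward submartingale if $\mathbb{E}(\mathbf{Y}_{n-1}\mid\mathcal{G}_n)\succeq\mathbf{Y}_n$ almost surely for all $n\ge1$. *)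

theory Defs
  imports "HOL-Probability.Probability"
begin

definition sym_matrices :: "(real ^ 'd ^ 'd) set" where
  "sym_matrices = {A. transpose A = A}"

text \<open>Over the reals, nonnegativity of the quadratic form does not force symmetry, so symmetry is
  part of the definition.\<close>

definition psd_matrices :: "(real ^ 'd ^ 'd) set" where
  "psd_matrices = {A \<in> sym_matrices. \<forall>v. 0 \<le> v \<bullet> (A *v v)}"

definition pd_matrices :: "(real ^ 'd ^ 'd) set" where
  "pd_matrices = {A \<in> sym_matrices. \<forall>v. v \<noteq> 0 \<longrightarrow> 0 < v \<bullet> (A *v v)}"

text \<open>Not to be confused with the library's \<open>\<le>\<close> on vectors, which is entrywise.\<close>

definition loewner_le :: "real ^ 'd ^ 'd \<Rightarrow> real ^ 'd ^ 'd \<Rightarrow> bool" (infix \<open>\<preceq>\<close> 50) where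
  "A \<preceq> B \<longleftrightarrow> B - A \<in> psd_matrices"

definition matrix_integrable :: "'a measure \<Rightarrow> ('a \<Rightarrow> real ^ 'n ^ 'm) \<Rightarrow> bool" where
  "matrix_integrable M X \<longleftrightarrow> (\<forall>i j. integrable M (\<lambda>\<omega>. X \<omega> $ i $ j))"

definition matrix_expectation :: "'a measure \<Rightarrow> ('a \<Rightarrow> real ^ 'n ^ 'm) \<Rightarrow> real ^ 'n ^ 'm" where
  "matrix_expectation M X = (\<chi> i j. \<integral>\<omega>. X \<omega> $ i $ j \<partial>M)"

definition matrix_cond_exp ::
  "'a measure \<Rightarrow> 'a measure \<Rightarrow> ('a \<Rightarrow> real ^ 'n ^ 'm) \<Rightarrow> 'a \<Rightarrow> real ^ 'n ^ 'm" where
  "matrix_cond_exp M F X \<omega> = (\<chi> i j. real_cond_exp M F (\<lambda>\<omega>'. X \<omega>' $ i $ j) \<omega>)"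

text \<open>Following the library's treatment of conditional expectation, a sub-\<open>\<sigma>\<close>-algebra is given as a
  measure of which only the space and the measurable sets matter.\<close>

definition backward_filtration :: "'a measure \<Rightarrow> (nat \<Rightarrow> 'a measure) \<Rightarrow> bool" where
  "backward_filtration M G \<longleftrightarrow>
     (\<forall>n. subalgebra M (G n)) \<and> (\<forall>n. subalgebra (G n) (G (Suc n)))"

definition backward_submartingale ::
  "'a measure \<Rightarrow> (nat \<Rightarrow> 'a measure) \<Rightarrow> (nat \<Rightarrow> 'a \<Rightarrow> real ^ 'd ^ 'd) \<Rightarrow> bool" where
  "backward_submartingale M G Y \<longleftrightarrow>
     (\<forall>n. \<forall>\<omega>\<in>space M. Y n \<omega> \<in> sym_matrices) \<and>
     (\<forall>n. Y n \<in> borel_measurable (G n)) \<and>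
     (\<forall>n. matrix_integrable M (Y n)) \<and>
     (\<forall>n\<ge>1. AE \<omega> in M. Y n \<omega> \<preceq> matrix_cond_exp M (G n) (Y (n - 1)) \<omega>)"

end

theory Submission
  imports Defs
begin

text \<open>
  The scalar process \<open>tr (Y\<^sub>n A\<^sup>-\<^sup>1)\<close> is a nonnegative backward submartingale, because the trace of a
  product of two positive semidefinite matrices is nonnegative.  If \<open>Y\<^sub>n\<close> is not below \<open>A\<close>, some
  \<open>v\<close> has \<open>v \<bullet> Y\<^sub>n v > v \<bullet> A v > 0\<close>; since \<open>A\<^sup>-\<^sup>1 - v v\<^sup>T / (v \<bullet> A v)\<close> is positive semidefinite
  by Cauchy--Schwarz, \<open>tr (Y\<^sub>n A\<^sup>-\<^sup>1) \<ge> (v \<bullet> Y\<^sub>n v) / (v \<bullet> A v) > 1\<close>.  The claim is thus Doob's maximal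
  inequality for the scalar process, obtained by splitting according to the last index at which
  the threshold is exceeded.
\<close>

section \<open>Rank-one matrices and linearity of the trace\<close>

definition outer_square :: "real ^ 'd \<Rightarrow> real ^ 'd ^ 'd" where
  "outer_square w = (\<chi> i j. w $ i * w $ j)"

lemma outer_square_mult_vec: "outer_square w *v v = (w \<bullet> v) *\<^sub>R w"
  by (simp add: vec_eq_iff outer_square_def matrix_vector_mult_def inner_vec_def
      sum_distrib_left algebra_simps)

lemma transpose_outer_square: "transpose (outer_square w) = outer_square w"
  by (simp add: outer_square_def transpose_def vec_eq_iff mult.commute)

lemma trace_mult_eq_sum: "trace (X ** B) = (\<Sum>i\<in>UNIV. \<Sum>j\<in>UNIV. B $ j $ i * X $ i $ j)"
  for X B :: "real ^ 'd ^ 'd"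
  by (simp add: trace_def matrix_matrix_mult_def mult.commute)

lemma trace_mult_outer_square: "trace (X ** outer_square w) = w \<bullet> (X *v w)"
  unfolding trace_mult_eq_sum
  by (simp add: outer_square_def matrix_vector_mult_def inner_vec_def
      sum_distrib_left mult_ac)

lemma trace_mult_add_scaleR:
  "trace (X ** (B + r *\<^sub>R C)) = trace (X ** B) + r * trace (X ** C)"
  for X B C :: "real ^ 'd ^ 'd"
  by (simp add: trace_mult_eq_sum sum.distrib sum_distrib_left algebra_simps)

lemma trace_diff_mult: "trace ((X - Z) ** B) = trace (X ** B) - trace (Z ** B)"
  for X Z B :: "real ^ 'd ^ 'd"
  by (simp add: trace_mult_eq_sum sum_subtractf algebra_simps)

section \<open>Positive semidefinite forms and their deflation\<close>

lemma sym_matrices_inner: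
  assumes "C \<in> sym_matrices"
  shows "u \<bullet> (C *v v) = (C *v u) \<bullet> v"
  using assms by (metis (mono_tags) sym_matrices_def mem_Collect_eq dot_lmul_matrix
      transpose_matrix_vector)

lemma pd_matrices_subset_psd_matrices: "pd_matrices \<subseteq> psd_matrices"
proof
  fix A :: "real ^ 'd ^ 'd" assume "A \<in> pd_matrices"
  then have "A \<in> sym_matrices" "\<And>v. v \<noteq> 0 \<Longrightarrow> 0 < v \<bullet> (A *v v)"
    by (auto simp: pd_matrices_def)
  then have "0 \<le> v \<bullet> (A *v v)" for v
    by (cases "v = 0") (auto intro: less_imp_le)
  with \<open>A \<in> sym_matrices\<close> show "A \<in> psd_matrices"
    by (simp add: psd_matrices_def)
qed

lemma psd_matrices_quadratic:
  assumes "C \<in> psd_matrices"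
  shows "0 \<le> v \<bullet> (C *v v) - 2 * t * (v \<bullet> (C *v w)) + t\<^sup>2 * (w \<bullet> (C *v w))"
proof -
  have "0 \<le> (v - t *\<^sub>R w) \<bullet> (C *v (v - t *\<^sub>R w))"
    using assms by (simp add: psd_matrices_def)
  moreover have "w \<bullet> (C *v v) = v \<bullet> (C *v w)"
    using assms sym_matrices_inner[of C w v] by (simp add: psd_matrices_def inner_commute)
  ultimately show ?thesis
    by (simp add: matrix_vector_mult_diff_distrib matrix_vector_mult_scaleR inner_diff_left
        inner_diff_right power2_eq_square algebra_simps)
qed

text \<open>When the coefficient of \<open>t\<^sup>2\<close> in
  \<open>psd_matrices_quadratic\<close> vanishes, the bound is affine in \<open>t\<close>. An affine
  function bounded below has slope zero, and for \<open>v = C *v w\<close> the slope is a multiple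
  of \<open>v \<bullet> v\<close>.\<close>

lemma psd_matrices_null_vector:
  assumes "C \<in> psd_matrices" and "w \<bullet> (C *v w) = 0"
  shows "C *v w = 0"
proof (rule ccontr)
  assume "C *v w \<noteq> 0"
  define v where "v = C *v w"
  have pos: "0 < v \<bullet> v"
    using \<open>C *v w \<noteq> 0\<close> by (simp add: v_def)
  \<comment> \<open>With this \<open>t\<close> the affine expression equals -1.\<close>
  define t where "t = (v \<bullet> (C *v v) + 1) / (2 * (v \<bullet> v))"
  have "0 \<le> v \<bullet> (C *v v) - 2 * t * (v \<bullet> v)"
    using psd_matrices_quadratic[OF assms(1), of v t w] assms(2) by (simp add: v_def)
  moreover have "2 * t * (v \<bullet> v) = v \<bullet> (C *v v) + 1"
    using pos by (simp add: t_def)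
  ultimately show False by simp
qed

text \<open>This is Cauchy-Schwarz for the form of \<open>C\<close>: the square of
  \<open>v \<bullet> (C *v w)\<close> is at most the product of the values of the form at
  \<open>v\<close> and \<open>w\<close>. Used with a basis vector \<open>w\<close> for elimination,
  and with \<open>C\<close> the inverse of \<open>A\<close> and \<open>w = A *v v\<close> for the
  trace bound.\<close>

lemma psd_matrices_deflate:
  assumes "C \<in> psd_matrices" and pos: "0 < w \<bullet> (C *v w)"
  shows "C - (1 / (w \<bullet> (C *v w))) *\<^sub>R outer_square (C *v w) \<in> psd_matrices"
proof -
  define q where "q = w \<bullet> (C *v w)"
  have "q > 0" using pos by (simp add: q_def)
  let ?D = "C - (1 / q) *\<^sub>R outer_square (C *v w)"
  have "transpose ?D = ?D"
    using assms(1) transpose_outer_square[of "C *v w"]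
    by (simp add: psd_matrices_def sym_matrices_def transpose_def vec_eq_iff)
  moreover have "0 \<le> v \<bullet> (?D *v v)" for v
  proof -
    define p where "p = v \<bullet> (C *v w)"
    \<comment> \<open>The parameter \<open>p / q\<close> minimises the quadratic in
      \<open>t\<close>.\<close>
    have "0 \<le> v \<bullet> (C *v v) - 2 * (p / q) * p + (p / q)\<^sup>2 * q"
      using psd_matrices_quadratic[OF assms(1), of v "p / q" w] by (simp add: p_def q_def)
    also have "\<dots> = v \<bullet> (C *v v) - (1 / q) * (p * p)"
      using \<open>q > 0\<close> by (simp add: power2_eq_square field_simps)
    also have "\<dots> = v \<bullet> (?D *v v)"
      by (simp add: matrix_vector_mult_diff_rdistrib scaleR_matrix_vector_assoc[symmetric]
          outer_square_mult_vec inner_diff_right p_def inner_commute)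
    finally show ?thesis .
  qed
  ultimately show ?thesis
    by (simp add: psd_matrices_def sym_matrices_def q_def)
qed

text \<open>Symmetric Gaussian elimination: each deflation clears one row and column and splits off a
  rank-one term, whose contribution to the trace is a value of the quadratic form of \<open>X\<close>.\<close>

lemma trace_mult_psd_nonneg_supported:
  fixes X C :: "real ^ 'd ^ 'd"
  assumes X: "X \<in> psd_matrices" and "finite S"
  shows "C \<in> psd_matrices \<Longrightarrow> (\<And>i j. i \<notin> S \<Longrightarrow> C $ i $ j = 0) \<Longrightarrow> 0 \<le> trace (X ** C)"
  using \<open>finite S\<close>
proof (induction S arbitrary: C rule: finite_induct)
  case empty
  then show ?case by (simp add: trace_mult_eq_sum)
next
  case (insert k S)
  define e :: "real ^ 'd" where "e = axis k 1"
  define c where "c = C *v e"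
  have col: "c $ i = C $ i $ k" for i
    by (simp add: c_def e_def matrix_vector_mul_component inner_axis)
  have sym: "C $ i $ j = C $ j $ i" for i j
    using insert.prems(1)
    by (simp add: psd_matrices_def sym_matrices_def transpose_def vec_eq_iff)
  have quad: "e \<bullet> c = C $ k $ k"
    by (simp add: e_def inner_axis' col)
  show ?case
  \<comment> \<open>A zero pivot makes the whole row \<open>k\<close> vanish, so \<open>C\<close> is
    already supported on \<open>S\<close> and nothing has to be split off.\<close>
  proof (cases "C $ k $ k = 0")
    case True
    then have "c = 0"
      using psd_matrices_null_vector[OF insert.prems(1), of e] quad by (simp add: c_def)
    then have "C $ k $ j = 0" for j
      using col[of j] sym[of k j] by simp
    then have "C $ i $ j = 0" if "i \<notin> S" for i j
      using insert.prems(2)[of i j] that by (cases "i = k") auto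
    then show ?thesis
      using insert.IH insert.prems(1) by blast
  next
    case False
    define q where "q = C $ k $ k"
    have "0 \<le> e \<bullet> (C *v e)"
      using insert.prems(1) by (simp add: psd_matrices_def)
    then have "q > 0" using False quad by (simp add: q_def c_def)
    define D where "D = C - (1 / q) *\<^sub>R outer_square c"
    have "D \<in> psd_matrices"
      using psd_matrices_deflate[OF insert.prems(1), of e] quad \<open>q > 0\<close>
      by (simp add: D_def q_def c_def)
    \<comment> \<open>Row \<open>k\<close> of \<open>D\<close> has entries
      \<open>C $ k $ j - C $ j $ k\<close>, zero by symmetry. In any other row outside
      \<open>S\<close> both \<open>C $ i $ j\<close> and \<open>c $ i\<close> are zero.\<close>
    moreover have "D $ i $ j = 0" if "i \<notin> S" for i j
    proof (cases "i = k")
      case True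
      then show ?thesis
        using \<open>q > 0\<close> sym[of k j] by (simp add: D_def outer_square_def col q_def)
    next
      case False
      then show ?thesis
        using insert.prems(2)[of i] that by (simp add: D_def outer_square_def col)
    qed
    ultimately have "0 \<le> trace (X ** D)"
      using insert.IH by blast
    moreover have "0 \<le> c \<bullet> (X *v c)"
      using X by (simp add: psd_matrices_def)
    moreover have "trace (X ** C) = trace (X ** D) + (1 / q) * (c \<bullet> (X *v c))"
      using trace_mult_add_scaleR[of X D "1 / q" "outer_square c"]
      by (simp add: D_def trace_mult_outer_square)
    ultimately show ?thesis
      using \<open>q > 0\<close> by simp
  qed
qed

lemma trace_mult_psd_nonneg:
  fixes X C :: "real ^ 'd ^ 'd"
  assumes "X \<in> psd_matrices" and "C \<in> psd_matrices"
  shows "0 \<le> trace (X ** C)"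
  using trace_mult_psd_nonneg_supported[OF assms(1), of UNIV C] assms(2) by simp

section \<open>Inverses of positive definite matrices and the trace threshold\<close>

lemma pd_matrices_invertible:
  assumes "A \<in> pd_matrices"
  shows "invertible A"
proof -
  have "v = 0" if "A *v v = 0" for v
    using assms that by (force simp: pd_matrices_def)
  then show ?thesis
    unfolding invertible_left_inverse matrix_left_invertible_ker by blast
qed

lemma matrix_mult_matrix_inv:
  assumes "invertible A"
  shows "A ** matrix_inv A = mat 1" and "matrix_inv A ** A = mat 1"
  using someI_ex[OF assms[unfolded invertible_def]] by (simp_all add: matrix_inv_def)

text \<open>The transposed inverse is again a left inverse of the symmetric \<open>A\<close>, hence
  equals the inverse. The form of the inverse at \<open>u\<close> is the form of \<open>A\<close> at
  \<open>matrix_inv A *v u\<close>.\<close>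

lemma matrix_inv_pd_matrices:
  assumes "A \<in> pd_matrices"
  shows "matrix_inv A \<in> pd_matrices"
proof -
  let ?B = "matrix_inv A"
  note inv = pd_matrices_invertible[OF assms]
  have AB: "A *v (?B *v u) = u" for u
    by (simp add: matrix_vector_mul_assoc matrix_mult_matrix_inv(1)[OF inv])
  have A: "transpose A = A" "\<And>v. v \<noteq> 0 \<Longrightarrow> 0 < v \<bullet> (A *v v)"
    using assms by (auto simp: pd_matrices_def sym_matrices_def)
  have "transpose ?B ** A = mat 1"
    using arg_cong[OF matrix_mult_matrix_inv(1)[OF inv], of transpose] A(1)
    by (simp add: matrix_transpose_mul transpose_mat)
  then have "transpose ?B ** (A ** ?B) = ?B"
    by (simp add: matrix_mul_assoc)
  then have "transpose ?B = ?B"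
    by (simp add: matrix_mult_matrix_inv(1)[OF inv])
  moreover have "0 < u \<bullet> (?B *v u)" if "u \<noteq> 0" for u
  proof -
    have "?B *v u \<noteq> 0" using AB[of u] that by auto
    then show ?thesis
      using A(2)[of "?B *v u"] by (simp add: AB inner_commute)
  qed
  ultimately show ?thesis by (simp add: pd_matrices_def sym_matrices_def)
qed

lemma trace_mult_inv_ge_1:
  assumes X: "X \<in> psd_matrices" and A: "A \<in> pd_matrices" and "\<not> X \<preceq> A"
  shows "1 \<le> trace (X ** matrix_inv A)"
proof -
  let ?B = "matrix_inv A"
  \<comment> \<open>Symmetry of the difference ensures that the order can fail only through a
    negative value of the quadratic form.\<close>
  have "A - X \<in> sym_matrices"
    using X A by (simp add: psd_matrices_def pd_matrices_def sym_matrices_def transpose_def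
        vec_eq_iff)
  with \<open>\<not> X \<preceq> A\<close> obtain v where v: "v \<bullet> ((A - X) *v v) < 0"
    by (auto simp: loewner_le_def psd_matrices_def not_le)
  define q where "q = v \<bullet> (A *v v)"
  have Xv: "q < v \<bullet> (X *v v)"
    using v by (simp add: q_def matrix_vector_mult_diff_rdistrib inner_diff_right)
  have "v \<noteq> 0" using v by auto
  then have "q > 0" using A by (simp add: q_def pd_matrices_def)
  have B: "?B \<in> psd_matrices"
    using matrix_inv_pd_matrices[OF A] pd_matrices_subset_psd_matrices by blast
  have BA: "?B *v (A *v v) = v"
    by (simp add: matrix_vector_mul_assoc
        matrix_mult_matrix_inv(2)[OF pd_matrices_invertible[OF A]])
  define D where "D = ?B - (1 / q) *\<^sub>R outer_square v"
  \<comment> \<open>Deflating \<open>?B\<close> at \<open>A *v v\<close> removes exactly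
    \<open>outer_square v\<close>, since \<open>?B\<close> sends \<open>A *v v\<close> to
    \<open>v\<close>; the denominator becomes \<open>q\<close>.\<close>
  have "D \<in> psd_matrices"
    using psd_matrices_deflate[OF B, of "A *v v"] \<open>q > 0\<close>
    by (simp add: BA D_def q_def inner_commute)
  then have "0 \<le> trace (X ** D)" by (rule trace_mult_psd_nonneg[OF X])
  moreover have "trace (X ** ?B) = trace (X ** D) + (v \<bullet> (X *v v)) / q"
    using trace_mult_add_scaleR[of X D "1 / q" "outer_square v"]
    by (simp add: D_def trace_mult_outer_square)
  moreover have "1 \<le> (v \<bullet> (X *v v)) / q"
    using Xv \<open>q > 0\<close> by simp
  ultimately show ?thesis by simp
qed

section \<open>Doob's maximal inequality for scalar backward submartingales\<close>

text \<open>A set of \<open>G (Suc n)\<close> also lies in \<open>G n\<close>, so the averaging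
  property of conditional expectation over \<open>E\<close> can be applied at every index down to
  0.\<close>

lemma (in finite_measure) backward_submartingale_set_integral_mono:
  fixes Z :: "nat \<Rightarrow> 'a \<Rightarrow> real"
  assumes filt: "backward_filtration M G"
    and int: "\<And>n. integrable M (Z n)"
    and sub: "\<And>n. AE \<omega> in M. Z (Suc n) \<omega> \<le> real_cond_exp M (G (Suc n)) (Z n) \<omega>"
    and E: "E \<in> sets (G n)"
  shows "(\<integral>\<omega>\<in>E. Z n \<omega> \<partial>M) \<le> (\<integral>\<omega>\<in>E. Z 0 \<omega> \<partial>M)"
  using E
proof (induction n)
  case 0
  then show ?case by simp
next
  case (Suc n)
  have subalg: "subalgebra M (G m)" for m
    using filt by (simp add: backward_filtration_def)
  interpret S: finite_measure_subalgebra M "G (Suc n)"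
    by unfold_locales (rule subalg)
  have "E \<in> sets M"
    using Suc.prems subalg[of "Suc n"] by (auto simp: subalgebra_def)
  have "(\<integral>\<omega>\<in>E. Z (Suc n) \<omega> \<partial>M) \<le> (\<integral>\<omega>\<in>E. real_cond_exp M (G (Suc n)) (Z n) \<omega> \<partial>M)"
    unfolding set_lebesgue_integral_def
  proof (rule integral_mono_AE)
    show "integrable M (\<lambda>\<omega>. indicator E \<omega> *\<^sub>R Z (Suc n) \<omega>)"
      "integrable M (\<lambda>\<omega>. indicator E \<omega> *\<^sub>R real_cond_exp M (G (Suc n)) (Z n) \<omega>)"
      using \<open>E \<in> sets M\<close> int S.real_cond_exp_int(1) by (blast intro: integrable_mult_indicator)+
    show "AE \<omega> in M. indicator E \<omega> *\<^sub>R Z (Suc n) \<omega>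
        \<le> indicator E \<omega> *\<^sub>R real_cond_exp M (G (Suc n)) (Z n) \<omega>"
      using sub[of n] by eventually_elim (simp add: indicator_def)
  qed
  also have "\<dots> = (\<integral>\<omega>\<in>E. Z n \<omega> \<partial>M)"
    using S.real_cond_exp_intA[OF int Suc.prems] by simp
  also have "\<dots> \<le> (\<integral>\<omega>\<in>E. Z 0 \<omega> \<partial>M)"
    using filt Suc.prems by (intro Suc.IH) (auto simp: backward_filtration_def subalgebra_def)
  finally show ?case .
qed

text \<open>Later events lie in smaller sigma-algebras, so "\<open>m\<close> is the last index up to
  \<open>N\<close> with \<open>c \<le> Z m\<close>" is an event of \<open>G m\<close>. On it
  \<open>Z m\<close> is at least \<open>c\<close>, and its integral there is at most that of
  \<open>Z 0\<close>.\<close>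

lemma (in finite_measure) backward_maximal_inequality:
  fixes Z :: "nat \<Rightarrow> 'a \<Rightarrow> real"
  assumes filt: "backward_filtration M G"
    and meas: "\<And>n. Z n \<in> borel_measurable (G n)"
    and int: "\<And>n. integrable M (Z n)"
    and nonneg: "\<And>\<omega>. \<omega> \<in> space M \<Longrightarrow> 0 \<le> Z 0 \<omega>"
    and sub: "\<And>n. AE \<omega> in M. Z (Suc n) \<omega> \<le> real_cond_exp M (G (Suc n)) (Z n) \<omega>"
  shows "c * measure M {\<omega> \<in> space M. \<exists>n. c \<le> Z n \<omega>} \<le> (\<integral>\<omega>. Z 0 \<omega> \<partial>M)"
proof -
  define F where "F n = {\<omega> \<in> space M. c \<le> Z n \<omega>}" for n
  have subalg: "subalgebra M (G n)" and dec: "subalgebra (G n) (G (Suc n))" for n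
    using filt by (auto simp: backward_filtration_def)
  have FG: "F n \<in> sets (G n)" for n
  proof -
    have "F n = {\<omega> \<in> space (G n). c \<le> Z n \<omega>}"
      using subalg[of n] by (simp add: F_def subalgebra_def)
    then show ?thesis using meas[of n] by simp
  qed
  have GM: "E \<in> sets M" if "E \<in> sets (G n)" for E n
    using that subalg[of n] by (auto simp: subalgebra_def)
  have set_int: "set_integrable M E (Z n)" if "E \<in> sets M" for E n
    unfolding set_integrable_def using that int by (rule integrable_mult_indicator)
  \<comment> \<open>Downward induction on \<open>m\<close>, starting from the empty union at
    \<open>m = Suc N\<close>. Measurability is carried along because the next slice must lie in
    \<open>G m\<close>.\<close>
  have tail: "(\<Union>k\<in>{m..N}. F k) \<in> sets (G m) \<and>
      c * measure M (\<Union>k\<in>{m..N}. F k) \<le> (\<integral>\<omega>\<in>(\<Union>k\<in>{m..N}. F k). Z 0 \<omega> \<partial>M)"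
    if "m \<le> Suc N" for m N
    using that
  proof (induction m rule: inc_induct)
    case base
    then show ?case by (simp add: set_lebesgue_integral_def)
  next
    case (step m)
    define U where "U = (\<Union>k\<in>{Suc m..N}. F k)"
    \<comment> \<open>On \<open>E\<close> the threshold is reached at \<open>m\<close> and at no
      later index up to \<open>N\<close>.\<close>
    define E where "E = F m - U"
    have split: "(\<Union>k\<in>{m..N}. F k) = U \<union> E"
    proof -
      have "{m..N} = insert m {Suc m..N}" using step.hyps by auto
      then show ?thesis by (auto simp: U_def E_def)
    qed
    have UG: "U \<in> sets (G m)"
      using step.IH dec[of m] by (auto simp: U_def subalgebra_def)
    then have EG: "E \<in> sets (G m)" using FG by (simp add: E_def)
    have disj: "U \<inter> E = {}" by (auto simp: E_def)
    have "c * measure M E = (\<integral>\<omega>\<in>E. c \<partial>M)"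
      using GM[OF EG] by (simp add: set_lebesgue_integral_def mult.commute)
    also have "\<dots> \<le> (\<integral>\<omega>\<in>E. Z m \<omega> \<partial>M)"
    proof (rule set_integral_mono)
      show "set_integrable M E (\<lambda>_. c)"
        unfolding set_integrable_def
        by (rule integrable_mult_indicator[OF GM[OF EG]]) simp
    qed (use GM[OF EG] set_int in \<open>auto simp: E_def F_def\<close>)
    also have "\<dots> \<le> (\<integral>\<omega>\<in>E. Z 0 \<omega> \<partial>M)"
      by (rule backward_submartingale_set_integral_mono[OF filt int sub EG])
    finally have "c * measure M E \<le> (\<integral>\<omega>\<in>E. Z 0 \<omega> \<partial>M)" .
    moreover have "c * measure M U \<le> (\<integral>\<omega>\<in>U. Z 0 \<omega> \<partial>M)"
      using step.IH by (simp add: U_def)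
    moreover have "measure M (U \<union> E) = measure M U + measure M E"
      using finite_measure_Union[OF GM[OF UG] GM[OF EG] disj] .
    moreover have "(\<integral>\<omega>\<in>U \<union> E. Z 0 \<omega> \<partial>M) = (\<integral>\<omega>\<in>U. Z 0 \<omega> \<partial>M) + (\<integral>\<omega>\<in>E. Z 0 \<omega> \<partial>M)"
      using disj GM[OF UG] GM[OF EG] set_int by (intro set_integral_Un) auto
    ultimately show ?case
      using UG EG by (simp add: split algebra_simps)
  qed
  have bound: "c * measure M (\<Union>k\<le>N. F k) \<le> (\<integral>\<omega>. Z 0 \<omega> \<partial>M)" for N
  proof -
    let ?U = "\<Union>k\<in>{0..N}. F k"
    have "?U \<in> sets M" using GM FG by blast
    have "c * measure M ?U \<le> (\<integral>\<omega>\<in>?U. Z 0 \<omega> \<partial>M)" using tail[of 0 N] by simp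
    \<comment> \<open>Enlarging the domain of integration uses
      \<open>0 \<le> Z 0 \<omega>\<close>.\<close>
    also have "\<dots> \<le> (\<integral>\<omega>. Z 0 \<omega> \<partial>M)"
      unfolding set_lebesgue_integral_def
      using int nonneg \<open>?U \<in> sets M\<close>
      by (intro integral_mono integrable_mult_indicator) (auto simp: indicator_def)
    finally show ?thesis by (simp add: atMost_atLeast0)
  qed
  \<comment> \<open>Continuity from below removes the finite horizon.\<close>
  have "(\<lambda>N. measure M (\<Union>k\<le>N. F k)) \<longlonglongrightarrow> measure M (\<Union>N. \<Union>k\<le>N. F k)"
    using GM FG by (intro finite_Lim_measure_incseq)
      (auto simp: incseq_def image_subset_iff intro: order_trans intro!: sets.finite_UN)
  then have "c * measure M (\<Union>N. \<Union>k\<le>N. F k) \<le> (\<integral>\<omega>. Z 0 \<omega> \<partial>M)"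
    by (rule LIMSEQ_le_const2[OF tendsto_mult_left]) (use bound in auto)
  moreover have "(\<Union>N. \<Union>k\<le>N. F k) = {\<omega> \<in> space M. \<exists>n. c \<le> Z n \<omega>}"
    by (auto simp: F_def)
  ultimately show ?thesis by simp
qed

section \<open>From the matrix process to the scalar process\<close>

text \<open>The trace against a fixed \<open>B\<close> is a finite linear combination of entries.
  Conditional expectation is linear only almost everywhere, so the exceptional null sets of all
  indices are first merged.\<close>

lemma (in finite_measure_subalgebra) real_cond_exp_trace_mult:
  fixes X :: "'a \<Rightarrow> real ^ 'd ^ 'd"
  assumes "matrix_integrable M X"
  shows "AE \<omega> in M. real_cond_exp M F (\<lambda>\<omega>. trace (X \<omega> ** B)) \<omega>
    = trace (matrix_cond_exp M F X \<omega> ** B)"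
proof -
  have int: "integrable M (\<lambda>\<omega>. X \<omega> $ i $ j)" for i j
    using assms by (simp add: matrix_integrable_def)
  have 1: "AE \<omega> in M. real_cond_exp M F (\<lambda>\<omega>. \<Sum>i\<in>UNIV. \<Sum>j\<in>UNIV. B $ j $ i * X \<omega> $ i $ j) \<omega>
    = (\<Sum>i\<in>UNIV. real_cond_exp M F (\<lambda>\<omega>. \<Sum>j\<in>UNIV. B $ j $ i * X \<omega> $ i $ j) \<omega>)"
    using int by (intro real_cond_exp_sum) auto
  have 2: "AE \<omega> in M. \<forall>i. real_cond_exp M F (\<lambda>\<omega>. \<Sum>j\<in>UNIV. B $ j $ i * X \<omega> $ i $ j) \<omega>
    = (\<Sum>j\<in>UNIV. real_cond_exp M F (\<lambda>\<omega>. B $ j $ i * X \<omega> $ i $ j) \<omega>)"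
    using int by (intro AE_all_countable[THEN iffD2] allI real_cond_exp_sum) auto
  have 3: "AE \<omega> in M. \<forall>i j. real_cond_exp M F (\<lambda>\<omega>. B $ j $ i * X \<omega> $ i $ j) \<omega>
    = B $ j $ i * real_cond_exp M F (\<lambda>\<omega>. X \<omega> $ i $ j) \<omega>"
    using int by (intro AE_all_countable[THEN iffD2] allI real_cond_exp_cmult) auto
  show ?thesis
    using 1 2 3 by eventually_elim (simp add: trace_mult_eq_sum matrix_cond_exp_def)
qed

theorem theorem4p3:
  fixes M :: "'a measure"
    and G :: "nat \<Rightarrow> 'a measure"
    and Y :: "nat \<Rightarrow> 'a \<Rightarrow> real ^ 'd ^ 'd"
    and A :: "real ^ 'd ^ 'd"
  assumes "prob_space M"
    and "backward_filtration M G"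
    and "backward_submartingale M G Y"
    and "\<And>n \<omega>. \<omega> \<in> space M \<Longrightarrow> Y n \<omega> \<in> psd_matrices"
    and "A \<in> pd_matrices"
  shows "measure M {\<omega> \<in> space M. \<exists>n. \<not> Y n \<omega> \<preceq> A}
           \<le> trace (matrix_expectation M (Y 0) ** matrix_inv A)"
proof -
  interpret prob_space M by fact
  let ?B = "matrix_inv A"
  define Z where "Z n \<omega> = trace (Y n \<omega> ** ?B)" for n \<omega>
  have subalg: "subalgebra M (G n)" for n
    using assms(2) by (simp add: backward_filtration_def)
  \<comment> \<open>Reading the defining inequality at \<open>Suc n\<close> turns
    \<open>Y (n - 1)\<close> into \<open>Y n\<close>.\<close>
  have Ymeas: "Y n \<in> borel_measurable (G n)" and Yint: "matrix_integrable M (Y n)"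
    and Ysub: "AE \<omega> in M. Y (Suc n) \<omega> \<preceq> matrix_cond_exp M (G (Suc n)) (Y n) \<omega>" for n
    using assms(3) by (auto simp: backward_submartingale_def dest: spec[of _ "Suc n"])
  have B: "?B \<in> psd_matrices"
    using matrix_inv_pd_matrices[OF assms(5)] pd_matrices_subset_psd_matrices by blast
  have Zint: "integrable M (Z n)" for n
    using Yint[of n] by (simp add: Z_def[abs_def] trace_mult_eq_sum matrix_integrable_def)
  have Zmeas: "Z n \<in> borel_measurable (G n)" for n
  proof -
    have "(\<lambda>X. trace (X ** ?B)) \<in> borel_measurable borel"
      unfolding trace_mult_eq_sum by (intro borel_measurable_continuous_onI continuous_intros)
    from measurable_compose[OF Ymeas this] show ?thesis by (simp add: Z_def[abs_def])
  qed
  have Znonneg: "0 \<le> Z n \<omega>" if "\<omega> \<in> space M" for n \<omega>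
    unfolding Z_def using assms(4) B that by (intro trace_mult_psd_nonneg)
  have Zsub: "AE \<omega> in M. Z (Suc n) \<omega> \<le> real_cond_exp M (G (Suc n)) (Z n) \<omega>" for n
  proof -
    interpret S: finite_measure_subalgebra M "G (Suc n)"
      by unfold_locales (rule subalg)
    show ?thesis
      \<comment> \<open>The conditional increment is positive semidefinite, so its trace against
        \<open>?B\<close> is nonnegative.\<close>
      using S.real_cond_exp_trace_mult[OF Yint, of n ?B] Ysub[of n]
    proof eventually_elim
      case (elim \<omega>)
      then show ?case
        using trace_mult_psd_nonneg[OF _ B]
        by (fastforce simp: Z_def[abs_def] loewner_le_def trace_diff_mult)
    qed
  qed
  \<comment> \<open>Monotonicity of the measure asks for measurability of the larger event, a
    countable union of level sets.\<close>
  have "Measurable.pred M (\<lambda>\<omega>. 1 \<le> Z n \<omega>)" for n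
    using Zint[of n] by measurable
  then have "{\<omega> \<in> space M. \<exists>n. 1 \<le> Z n \<omega>} \<in> events"
    by measurable
  then have "prob {\<omega> \<in> space M. \<exists>n. \<not> Y n \<omega> \<preceq> A} \<le> prob {\<omega> \<in> space M. \<exists>n. 1 \<le> Z n \<omega>}"
    using trace_mult_inv_ge_1[OF assms(4) assms(5)]
    by (intro finite_measure_mono) (auto simp: Z_def)
  also have "\<dots> \<le> (\<integral>\<omega>. Z 0 \<omega> \<partial>M)"
    using backward_maximal_inequality[OF assms(2) Zmeas Zint Znonneg Zsub, of 1] by simp
  also have "\<dots> = trace (matrix_expectation M (Y 0) ** ?B)"
    using Yint[of 0] by (simp add: Z_def trace_mult_eq_sum matrix_expectation_def
        matrix_integrable_def)
  finally show ?thesis .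
qed

end
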